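(* Let $G=(V,E,e)$ be a finite connected rooted graph with at least two vertices and let $\sigma=\deg(e)$. Let $A^{[2]}_n$ be the adjacency matrix of the distance-$2$ graph of the free power $G^{*n}$. Then the distribution of $(n\sigma)^{-1}A^{[2]}_n$ with respect to the vacuum state converges in moments, as $n\to\infty$, to the distribution of $s^2-1$, where $s$ is a random variable with the semicircle law.
   Context: Free power: let $V^0=V\setminus\{e\}$. The vertices of $G^{*n}$ are the empty word (the root, denoted $e$) and all finite words $(v_1,i_1)\cdots(v_m,i_m)$ with $v_r\in V^0$, $i_r\in\{1,\dots,n\}$, $i_r\neq i_{r+1}$. For $i\in\{1,\dots,n\}$, a word $u$ whose first letter (if any) does not have index $i$, and $w\in V$, let $w\cdot_i u$ be $(w,i)u$ if $w\in V^0$ and $u$ if $w=e$; vertices $x,y$ are adjacent iff $x=v\cdot_i u$, $y=v'\cdot_i u$ for some such $i,u$ and some edge $\{v,v'\}\in E$. The distance-$2$ graph has the same vertices, with $x,y$ adjacent iff their distance is exactly $2$. The vacuum state is $M\mapsto M_{ee}$; the distribution of $M$ is the measure with moments $(M^m)_{ee}$. The semicircle law has density $\frac{1}{2\pi}\sqrt{4-x^2}$ on $[-2,2]$. *)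

theory Defs
  imports "HOL-Probability.Probability"
begin

text \<open>A graph is a vertex set together with a set of edges, an edge being an unordered pair of
  distinct vertices. The vertex set may be infinite.\<close>

definition simple_graph :: "'a set \<Rightarrow> 'a set set \<Rightarrow> bool" where
  "simple_graph V E \<longleftrightarrow> (\<forall>d\<in>E. d \<subseteq> V \<and> card d = 2)"

definition graph_walk :: "'a set \<Rightarrow> 'a set set \<Rightarrow> 'a \<Rightarrow> 'a list \<Rightarrow> 'a \<Rightarrow> bool" where
  "graph_walk V E x p y \<longleftrightarrow>
     p \<noteq> [] \<and> set p \<subseteq> V \<and> successively (\<lambda>a b. {a, b} \<in> E) p \<and> hd p = x \<and> last p = y"

definition graph_connected :: "'a set \<Rightarrow> 'a set set \<Rightarrow> bool" where
  "graph_connected V E \<longleftrightarrow> V \<noteq> {} \<and> (\<forall>x\<in>V. \<forall>y\<in>V. \<exists>p. graph_walk V E x p y)"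

definition graph_degree :: "'a set \<Rightarrow> 'a set set \<Rightarrow> 'a \<Rightarrow> nat" where
  "graph_degree V E x = card {y \<in> V. {x, y} \<in> E}"

text \<open>A walk is given by its list of vertices, so its length is one less than that of the list;
  the distance is infinite if there is no walk.\<close>

definition graph_dist :: "'a set \<Rightarrow> 'a set set \<Rightarrow> 'a \<Rightarrow> 'a \<Rightarrow> enat" where
  "graph_dist V E x y = (INF p\<in>{p. graph_walk V E x p y}. enat (length p - 1))"

definition distance_edges :: "nat \<Rightarrow> 'a set \<Rightarrow> 'a set set \<Rightarrow> 'a set set" where
  "distance_edges k V E = {{x, y} | x y. x \<in> V \<and> y \<in> V \<and> graph_dist V E x y = enat k}"

definition adjacency_matrix :: "'a set set \<Rightarrow> 'a \<Rightarrow> 'a \<Rightarrow> real" where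
  "adjacency_matrix E x y = (if {x, y} \<in> E then 1 else 0)"

definition free_power_verts :: "'a set \<Rightarrow> 'a \<Rightarrow> nat \<Rightarrow> ('a \<times> nat) list set" where
  "free_power_verts V e n = {w. set w \<subseteq> (V - {e}) \<times> {1..n} \<and> distinct_adj (map snd w)}"

definition word_prepend :: "'a \<Rightarrow> nat \<Rightarrow> 'a \<Rightarrow> ('a \<times> nat) list \<Rightarrow> ('a \<times> nat) list" where
  "word_prepend e i w u = (if w = e then u else (w, i) # u)"

definition free_power_edges ::
    "'a set \<Rightarrow> 'a set set \<Rightarrow> 'a \<Rightarrow> nat \<Rightarrow> ('a \<times> nat) list set set" where
  "free_power_edges V E e n =
     {{word_prepend e i v u, word_prepend e i v' u} | i u v v'.
        i \<in> {1..n} \<and> u \<in> free_power_verts V e n \<and> (u \<noteq> [] \<longrightarrow> snd (hd u) \<noteq> i) \<and> {v, v'} \<in> E}"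

text \<open>Powers of a matrix with rows and columns indexed by a possibly infinite set \<open>X\<close>. For
  matrices with finitely supported rows and columns, all sums involved are finite.\<close>

fun matrix_power :: "'a set \<Rightarrow> ('a \<Rightarrow> 'a \<Rightarrow> real) \<Rightarrow> nat \<Rightarrow> 'a \<Rightarrow> 'a \<Rightarrow> real" where
  "matrix_power X M 0 x y = (if x = y then 1 else 0)"
| "matrix_power X M (Suc m) x y = (\<Sum>\<^sub>\<infinity>z\<in>X. matrix_power X M m x z * M z y)"

text \<open>The distribution of \<open>M\<close> in the vacuum state at \<open>r\<close> is the measure having these moments.\<close>

definition vacuum_moment :: "'a set \<Rightarrow> 'a \<Rightarrow> ('a \<Rightarrow> 'a \<Rightarrow> real) \<Rightarrow> nat \<Rightarrow> real" where
  "vacuum_moment X r M m = matrix_power X M m r r"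

text \<open>\<open>a n m\<close> is the \<open>m\<close>-th moment of the \<open>n\<close>-th distribution; the limit distribution is
  required to have moments of all orders.\<close>

definition moments_converge_to :: "(nat \<Rightarrow> nat \<Rightarrow> real) \<Rightarrow> real measure \<Rightarrow> bool" where
  "moments_converge_to a \<mu> \<longleftrightarrow>
     (\<forall>m. integrable \<mu> (\<lambda>x. x ^ m) \<and> (\<lambda>n. a n m) \<longlonglongrightarrow> (\<integral>x. x ^ m \<partial>\<mu>))"

definition semicircle_density :: "real \<Rightarrow> real" where
  "semicircle_density x = (if x \<in> {-2..2} then sqrt (4 - x\<^sup>2) / (2 * pi) else 0)"

end

theory Submission
  imports Defs
begin

text \<open>Let \<open>T\<close> be the normalised adjacency matrix of the distance-2 graph, acting on functions of words
  with the weighted supremum norm \<open>\<parallel>F\<parallel> = sup |F x| n^(|x|/2)\<close>. A vertex has \<open>O(n\<^sup>2)\<close>, \<open>O(n)\<close>, \<open>O(n)\<close>,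
  \<open>O(1)\<close>, \<open>O(1)\<close> neighbours at distance 2 whose word is longer by \<open>2, 1, 0, -1, -2\<close>, so \<open>T\<close> is bounded
  uniformly in \<open>n\<close>. Let \<open>g\<^sub>k\<close> be \<open>(n\<sigma>)^(-k)\<close> times the indicator of the words of length \<open>2k\<close> all of whose
  letters are neighbours of the root. Then \<open>T g\<^sub>k = g\<^sub>k\<^sub>+\<^sub>1 + g\<^sub>k + g\<^sub>k\<^sub>-\<^sub>1 + O(n^(-1/2))\<close> for \<open>k \<ge> 1\<close> and
  \<open>T g\<^sub>0 = g\<^sub>1 + O(n^(-1/2))\<close>. The Chebyshev polynomials \<open>U\<^sub>2\<^sub>k(x/2)\<close> satisfy the same recursion exactly for
  multiplication by \<open>x\<^sup>2 - 1\<close>, and under the semicircle law they have mean \<open>0\<close> except for \<open>k = 0\<close>; hence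
  \<open>T\<^sup>m g\<^sub>0\<close> at the root converges to the \<open>m\<close>-th moment of \<open>s\<^sup>2 - 1\<close>.\<close>

section \<open>Distance 2 in terms of edges\<close>

text \<open>\<open>enat\<close> is well-ordered, so the infimum over a nonempty set of walk lengths
  is attained; without any walk it is infinite and exceeds \<open>enat k\<close>. The
  \<open>Suc\<close> appears because a walk of length \<open>k\<close> has \<open>k + 1\<close>
  vertices.\<close>

lemma graph_dist_le_iff:
  "graph_dist V E x y \<le> enat k \<longleftrightarrow> (\<exists>p. graph_walk V E x p y \<and> length p \<le> Suc k)"
proof
  assume le: "graph_dist V E x y \<le> enat k"
  let ?S = "(\<lambda>p. enat (length p - 1)) ` {p. graph_walk V E x p y}"
  have "?S \<noteq> {}"
  proof
    assume "?S = {}"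
    then have "graph_dist V E x y = \<infinity>"
      by (simp only: graph_dist_def Inf_empty top_enat_def)
    with le show False by simp
  qed
  then have "Inf ?S \<in> ?S"
    by (metis wellorder_InfI ex_in_conv)
  then show "\<exists>p. graph_walk V E x p y \<and> length p \<le> Suc k"
    using le unfolding graph_dist_def by auto
next
  assume "\<exists>p. graph_walk V E x p y \<and> length p \<le> Suc k"
  then obtain p where p: "graph_walk V E x p y" "length p \<le> Suc k" by blast
  have "graph_dist V E x y \<le> enat (length p - 1)"
    unfolding graph_dist_def by (rule INF_lower) (use p in simp)
  also have "\<dots> \<le> enat k" using p(2) by simp
  finally show "graph_dist V E x y \<le> enat k" .
qed

text \<open>Distance 2 means distance at most 2 but not at most 1, and walks on at most three
  vertices can be listed outright. Membership in \<open>V\<close> comes from the edges, which lie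
  inside \<open>V\<close> by \<open>simple_graph\<close>.\<close>

lemma graph_dist_eq_2_iff:
  assumes "simple_graph V E"
  shows "x \<in> V \<and> y \<in> V \<and> graph_dist V E x y = enat 2 \<longleftrightarrow>
    x \<noteq> y \<and> {x, y} \<notin> E \<and> (\<exists>z. {x, z} \<in> E \<and> {z, y} \<in> E)"
proof -
  have sub: "a \<in> V \<and> b \<in> V" if "{a, b} \<in> E" for a b
    using bspec[OF assms[unfolded simple_graph_def] that] by simp
  have w2: "(\<exists>p. graph_walk V E x p y \<and> length p \<le> Suc 2) \<longleftrightarrow>
      (x \<in> V \<and> x = y) \<or> {x, y} \<in> E \<or> (\<exists>z. {x, z} \<in> E \<and> {z, y} \<in> E)" (is "?L \<longleftrightarrow> ?R")
  proof
    assume ?L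
    then obtain p where p: "graph_walk V E x p y" "length p \<le> Suc 2" by blast
    then consider a where "p = [a]" | a b where "p = [a, b]" | a b c where "p = [a, b, c]"
      by (cases p; cases "tl p"; cases "tl (tl p)"; auto simp: graph_walk_def)
    then show ?R using p by cases (auto simp: graph_walk_def)
  next
    assume ?R
    then consider "x \<in> V" "x = y" | "{x, y} \<in> E" | z where "{x, z} \<in> E" "{z, y} \<in> E" by blast
    then show ?L
    proof cases
      case 1 then show ?thesis by (intro exI[of _ "[x]"]) (auto simp: graph_walk_def)
    next
      case 2 then show ?thesis using sub[OF 2]
        by (intro exI[of _ "[x, y]"]) (auto simp: graph_walk_def)
    next
      case 3 then show ?thesis using sub[OF 3(1)] sub[OF 3(2)]
        by (intro exI[of _ "[x, z, y]"]) (auto simp: graph_walk_def)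
    qed
  qed
  have w1: "(\<exists>p. graph_walk V E x p y \<and> length p \<le> Suc 1) \<longleftrightarrow>
      (x \<in> V \<and> x = y) \<or> {x, y} \<in> E" (is "?L \<longleftrightarrow> ?R")
  proof
    assume ?L
    then obtain p where p: "graph_walk V E x p y" "length p \<le> Suc 1" by blast
    then consider a where "p = [a]" | a b where "p = [a, b]"
      by (cases p; cases "tl p"; auto simp: graph_walk_def)
    then show ?R using p by cases (auto simp: graph_walk_def)
  next
    assume ?R
    then consider "x \<in> V" "x = y" | "{x, y} \<in> E" by blast
    then show ?L
    proof cases
      case 1 then show ?thesis by (intro exI[of _ "[x]"]) (auto simp: graph_walk_def)
    next
      case 2 then show ?thesis using sub[OF 2]
        by (intro exI[of _ "[x, y]"]) (auto simp: graph_walk_def)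
    qed
  qed
  have d2: "d = enat 2 \<longleftrightarrow> d \<le> enat 2 \<and> \<not> d \<le> enat 1" for d
    by (cases d) auto
  have "x \<in> V" if "{x, z} \<in> E" for z using sub[OF that] by simp
  moreover have "y \<in> V" if "{z, y} \<in> E" for z using sub[OF that] by simp
  ultimately show ?thesis
    unfolding d2 graph_dist_le_iff w1 w2 by meson
qed

text \<open>An edge determines its endpoints only up to order; symmetry of the condition on the
  right carries it from some order to the given one.\<close>

lemma distance_2_edges_iff:
  assumes "simple_graph V E"
  shows "{x, y} \<in> distance_edges 2 V E \<longleftrightarrow>
    x \<noteq> y \<and> {x, y} \<notin> E \<and> (\<exists>z. {x, z} \<in> E \<and> {z, y} \<in> E)"
proof -
  let ?P = "\<lambda>x y. x \<noteq> y \<and> {x, y} \<notin> E \<and> (\<exists>z. {x, z} \<in> E \<and> {z, y} \<in> E)"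
  have sym: "?P b a" if "?P a b" for a b
    using that by (metis insert_commute)
  have "{x, y} \<in> distance_edges 2 V E \<longleftrightarrow> (\<exists>a b. {x, y} = {a, b} \<and> ?P a b)"
    unfolding distance_edges_def mem_Collect_eq graph_dist_eq_2_iff[OF assms] by (rule refl)
  also have "\<dots> \<longleftrightarrow> ?P x y"
    unfolding doubleton_eq_iff using sym by blast
  finally show ?thesis .
qed

text \<open>\<open>riordan m k\<close> counts the \<open>m\<close>-step walks on the natural numbers from \<open>k\<close> to \<open>0\<close> with steps
  \<open>+1\<close>, \<open>-1\<close>, \<open>0\<close> that do not rest at \<open>0\<close>; \<open>riordan m 0\<close> is the \<open>m\<close>-th Riordan number.\<close>

fun riordan :: "nat \<Rightarrow> nat \<Rightarrow> real" where
  "riordan 0 k = of_bool (k = 0)"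
| "riordan (Suc m) k =
     riordan m (Suc k) + of_bool (k \<ge> 1) * (riordan m k + riordan m (k - 1))"

section \<open>Adjacency and spheres of radius 2 in the free power\<close>

locale rooted_graph =
  fixes V :: "'a set" and E :: "'a set set" and e :: 'a
  assumes simple: "simple_graph V E" and fin: "finite V" and root: "e \<in> V"
begin

definition root_nbrs :: "'a set" where
  "root_nbrs = {v \<in> V. {e, v} \<in> E}"

abbreviation \<sigma> :: nat where "\<sigma> \<equiv> card root_nbrs"

abbreviation X :: "nat \<Rightarrow> ('a \<times> nat) list set" where "X \<equiv> free_power_verts V e"

text \<open>Moves are classified by their effect on the word length, since all later counting is
  organised by length.\<close>

definition up_step :: "nat \<Rightarrow> ('a \<times> nat) list \<Rightarrow> ('a \<times> nat) list \<Rightarrow> bool" where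
  "up_step n x y \<longleftrightarrow> y \<in> X n \<and> (\<exists>v i. y = (v, i) # x \<and> v \<in> root_nbrs)"

definition lev_step :: "nat \<Rightarrow> ('a \<times> nat) list \<Rightarrow> ('a \<times> nat) list \<Rightarrow> bool" where
  "lev_step n x y \<longleftrightarrow> x \<in> X n \<and> y \<in> X n \<and>
     (\<exists>v v' i u. x = (v, i) # u \<and> y = (v', i) # u \<and> {v, v'} \<in> E)"

definition adj :: "nat \<Rightarrow> ('a \<times> nat) list \<Rightarrow> ('a \<times> nat) list \<Rightarrow> bool" where
  "adj n x y \<longleftrightarrow> up_step n x y \<or> up_step n y x \<or> lev_step n x y"

lemma edgeD: "{a, b} \<in> E \<Longrightarrow> a \<in> V \<and> b \<in> V \<and> a \<noteq> b"
  using simple unfolding simple_graph_def by fastforce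

lemma Cons_in_X: "(v, i) # u \<in> X n \<longleftrightarrow>
    v \<in> V \<and> v \<noteq> e \<and> i \<in> {1..n} \<and> u \<in> X n \<and> (u \<noteq> [] \<longrightarrow> snd (hd u) \<noteq> i)"
  by (cases u) (auto simp: free_power_verts_def)

lemma Nil_in_X [simp]: "[] \<in> X n"
  by (simp add: free_power_verts_def)

lemma root_nbrsD: "v \<in> root_nbrs \<Longrightarrow> v \<in> V \<and> v \<noteq> e \<and> {e, v} \<in> E \<and> {v, e} \<in> E"
  unfolding root_nbrs_def using edgeD by (auto simp: insert_commute)

lemma root_nbrsI: "{e, v} \<in> E \<Longrightarrow> v \<in> root_nbrs" "{v, e} \<in> E \<Longrightarrow> v \<in> root_nbrs"
  unfolding root_nbrs_def using edgeD by (auto simp: insert_commute)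

lemma finite_root_nbrs [simp]: "finite root_nbrs"
  unfolding root_nbrs_def using fin by simp

lemma lev_step_sym: "lev_step n x y \<Longrightarrow> lev_step n y x"
  unfolding lev_step_def by (metis insert_commute)

lemma adj_sym: "adj n x y \<Longrightarrow> adj n y x"
  unfolding adj_def using lev_step_sym by blast

lemma adj_in_X: "adj n x y \<Longrightarrow> x \<in> X n \<and> y \<in> X n \<and> x \<noteq> y"
  unfolding adj_def up_step_def lev_step_def using edgeD by (auto simp: Cons_in_X)

lemma free_power_edgesI:
  assumes "i \<in> {1..n}" "u \<in> X n" "u \<noteq> [] \<longrightarrow> snd (hd u) \<noteq> i" "{v, v'} \<in> E"
  shows "{word_prepend e i v u, word_prepend e i v' u} \<in> free_power_edges V E e n"
  unfolding free_power_edges_def using assms by blast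

text \<open>The endpoints of an edge of \<open>E\<close> are distinct, so at most one of them is
  \<open>e\<close>. If one is, \<open>word_prepend\<close> leaves its word equal to \<open>u\<close>
  and the edge adds or removes a front letter; if neither is, the front letter changes its vertex
  and keeps its index.\<close>

lemma adj_iff: "{x, y} \<in> free_power_edges V E e n \<longleftrightarrow> adj n x y"
proof
  assume "{x, y} \<in> free_power_edges V E e n"
  then obtain i u v v' where *: "{x, y} = {word_prepend e i v u, word_prepend e i v' u}"
      "i \<in> {1..n}" "u \<in> X n" "u \<noteq> [] \<longrightarrow> snd (hd u) \<noteq> i" "{v, v'} \<in> E"
    unfolding free_power_edges_def by auto
  have "adj n (word_prepend e i v u) (word_prepend e i v' u)"
  proof (cases "v = e \<or> v' = e")
    case True
    then show ?thesis using * edgeD[OF *(5)] root_nbrsI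
      by (auto simp: adj_def up_step_def word_prepend_def Cons_in_X)
  next
    case False
    then have "lev_step n (word_prepend e i v u) (word_prepend e i v' u)" 
      using * edgeD[OF *(5)] by (auto simp: lev_step_def word_prepend_def Cons_in_X)
    then show ?thesis by (simp add: adj_def)
  qed
  with *(1) show "adj n x y"
    using adj_sym by (auto simp: doubleton_eq_iff)
next
  have upE: "{x, y} \<in> free_power_edges V E e n" if up: "up_step n x y" for x y
  proof -
    obtain v i where "y \<in> X n" "y = (v, i) # x" "v \<in> root_nbrs"
      using up unfolding up_step_def by blast
    then show ?thesis using root_nbrsD[of v] free_power_edgesI[of i n x e v]
      by (simp add: Cons_in_X word_prepend_def)
  qed
  have levE: "{x, y} \<in> free_power_edges V E e n" if lev: "lev_step n x y" for x y
  proof -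
    obtain v v' i u where "y \<in> X n" "x \<in> X n" "x = (v, i) # u" "y = (v', i) # u" "{v, v'} \<in> E"
      using lev unfolding lev_step_def by blast
    then show ?thesis using free_power_edgesI[of i n u v v']
      by (simp add: Cons_in_X word_prepend_def)
  qed
  assume "adj n x y"
  then show "{x, y} \<in> free_power_edges V E e n"
    using upE[of x y] upE[of y x] levE unfolding adj_def by (auto simp: insert_commute)
qed

lemma simple_free_power: "simple_graph (X n) (free_power_edges V E e n)"
  unfolding simple_graph_def
proof
  fix d assume d: "d \<in> free_power_edges V E e n"
  then obtain x y where "d = {x, y}" unfolding free_power_edges_def by blast
  with d adj_in_X[of n x y] show "d \<subseteq> X n \<and> card d = 2"
    by (auto simp: adj_iff)
qed

definition sphere2 :: "nat \<Rightarrow> ('a \<times> nat) list \<Rightarrow> ('a \<times> nat) list set" where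
  "sphere2 n x = {y. x \<noteq> y \<and> \<not> adj n x y \<and> (\<exists>z. adj n x z \<and> adj n z y)}"

lemma sphere2_iff: "{x, y} \<in> distance_edges 2 (X n) (free_power_edges V E e n) \<longleftrightarrow> y \<in> sphere2 n x"
  unfolding distance_2_edges_iff[OF simple_free_power] adj_iff sphere2_def by simp

lemma sphere2_sym: "y \<in> sphere2 n x \<Longrightarrow> x \<in> sphere2 n y"
  unfolding sphere2_def using adj_sym by blast

lemma sphere2_in_X: "y \<in> sphere2 n x \<Longrightarrow> x \<in> X n \<and> y \<in> X n"
  unfolding sphere2_def using adj_in_X by blast

text \<open>Two moves, each up, level or down, give nine combinations; up followed by down only
  returns to \<open>x\<close>, which leaves eight. The cases are necessary conditions and may
  overlap, which suffices for upper bounds.\<close>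

lemma sphere2_cases:
  assumes "y \<in> sphere2 n x"
  obtains
    (up_up) v i w j where "y = (w, j) # (v, i) # x" "v \<in> root_nbrs" "w \<in> root_nbrs"
  | (up_lev) v j where "y = (v, j) # x"
  | (lev_up) w j v v' i u where "x = (v, i) # u" "y = (w, j) # (v', i) # u"
  | (down_up) v v' i j u where "x = (v, i) # u" "y = (v', j) # u" "v \<in> root_nbrs" "v' \<in> root_nbrs"
  | (lev_lev) v v' i u where "x = (v, i) # u" "y = (v', i) # u"
  | (down_lev) v i t t' l u where "x = (v, i) # (t, l) # u" "y = (t', l) # u"
  | (lev_down) v i where "x = (v, i) # y"
  | (down_down) v i w j where "x = (v, i) # (w, j) # y" "v \<in> root_nbrs" "w \<in> root_nbrs"
proof -
  obtain z where z: "x \<noteq> y" "adj n x z" "adj n z y"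
    using assms unfolding sphere2_def by blast
  from z(2) consider "up_step n x z" | "up_step n z x" | "lev_step n x z" unfolding adj_def by blast
  then show thesis
  proof cases
    case 1
    with z(3) consider "up_step n z y" | "up_step n y z" | "lev_step n z y" unfolding adj_def by blast
    then show thesis using 1 z(1) that(1,2) by cases (auto simp: up_step_def lev_step_def)
  next
    case 2
    with z(3) consider "up_step n z y" | "up_step n y z" | "lev_step n z y" unfolding adj_def by blast
    then show thesis using 2 that(4,6,8) by cases (auto simp: up_step_def lev_step_def)
  next
    case 3
    with z(3) consider "up_step n z y" | "up_step n y z" | "lev_step n z y" unfolding adj_def by blast
    then show thesis using 3 that(3,5,7) by cases (auto simp: up_step_def lev_step_def)
  qed
qed

section \<open>Counting the sphere of radius 2 by word length\<close>

abbreviation N :: nat where "N \<equiv> card V"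

lemma N_pos: "N \<ge> 1"
  using root fin by (metis One_nat_def Suc_leI card_gt_0_iff empty_iff)

lemma N_le_N2: "N \<le> N\<^sup>2"
  using N_pos by (simp add: power2_eq_square)

lemma sigma_le_N: "\<sigma> \<le> N"
  unfolding root_nbrs_def using fin by (intro card_mono) auto

lemma sphere2_lengths:
  "y \<in> sphere2 n x \<Longrightarrow> length y \<le> length x + 2 \<and> length x \<le> length y + 2"
  by (erule sphere2_cases) auto

text \<open>Only powers of \<open>n\<close> matter in these inclusions, so letters range freely over
  \<open>V \<times> {1..n}\<close>. Each free index costs a factor \<open>n\<close>; here there are
  two.\<close>

lemma sphere2_up_2:
  "{y \<in> sphere2 n x. length y = length x + 2} \<subseteq>
     (\<lambda>(a, b). a # b # x) ` ((V \<times> {1..n}) \<times> (V \<times> {1..n}))"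
proof
  fix y assume "y \<in> {y \<in> sphere2 n x. length y = length x + 2}"
  then have y: "y \<in> sphere2 n x" "length y = length x + 2" by auto
  from y(1) have "y \<in> X n" using sphere2_in_X by blast
  with y show "y \<in> (\<lambda>(a, b). a # b # x) ` ((V \<times> {1..n}) \<times> (V \<times> {1..n}))"
    by (cases rule: sphere2_cases) (auto simp: Cons_in_X image_iff)
qed

text \<open>Up-level puts a letter before \<open>x\<close>; level-up also changes the vertex of the
  first letter of \<open>x\<close> under its fixed index. Either way one index is free. For empty
  \<open>x\<close> the term \<open>hd x\<close> is unspecified, but then level-up does not
  occur.\<close>

lemma sphere2_up_1:
  "{y \<in> sphere2 n x. length y = length x + 1} \<subseteq> (\<lambda>a. a # x) ` (V \<times> {1..n}) \<union>
     (\<lambda>(a, v). a # (v, snd (hd x)) # tl x) ` ((V \<times> {1..n}) \<times> V)"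
proof
  fix y assume "y \<in> {y \<in> sphere2 n x. length y = length x + 1}"
  then have y: "y \<in> sphere2 n x" "length y = length x + 1" by auto
  from y(1) have "y \<in> X n" using sphere2_in_X by blast
  with y show "y \<in> (\<lambda>a. a # x) ` (V \<times> {1..n}) \<union>
     (\<lambda>(a, v). a # (v, snd (hd x)) # tl x) ` ((V \<times> {1..n}) \<times> V)"
    by (cases rule: sphere2_cases) (auto simp: Cons_in_X image_iff)
qed

text \<open>Down-up and level-level both replace just the first letter, so one index is
  free.\<close>

lemma sphere2_same:
  "{y \<in> sphere2 n x. length y = length x} \<subseteq> (\<lambda>a. a # tl x) ` (V \<times> {1..n})"
proof
  fix y assume "y \<in> {y \<in> sphere2 n x. length y = length x}"
  then have y: "y \<in> sphere2 n x" "length y = length x" by auto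
  from y(1) have "y \<in> X n" using sphere2_in_X by blast
  with y show "y \<in> (\<lambda>a. a # tl x) ` (V \<times> {1..n})"
    by (cases rule: sphere2_cases) (auto simp: Cons_in_X image_iff)
qed

text \<open>Level-down leaves the tail, and down-level changes the vertex of the second letter under
  its fixed index. No index is free, so the count is bounded independently of
  \<open>n\<close>.\<close>

lemma sphere2_down_1:
  "{y \<in> sphere2 n x. length y + 1 = length x} \<subseteq>
     insert (tl x) ((\<lambda>v. (v, snd (hd (tl x))) # tl (tl x)) ` V)"
proof
  fix y assume "y \<in> {y \<in> sphere2 n x. length y + 1 = length x}"
  then have y: "y \<in> sphere2 n x" "length y + 1 = length x" by auto
  from y(1) have "y \<in> X n" using sphere2_in_X by blast
  with y show "y \<in> insert (tl x) ((\<lambda>v. (v, snd (hd (tl x))) # tl (tl x)) ` V)"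
    by (cases rule: sphere2_cases) (auto simp: Cons_in_X image_iff)
qed

lemma sphere2_down_2: "{y \<in> sphere2 n x. length y + 2 = length x} \<subseteq> {tl (tl x)}"
proof
  fix y assume "y \<in> {y \<in> sphere2 n x. length y + 2 = length x}"
  then have y: "y \<in> sphere2 n x" "length y + 2 = length x" by auto
  then show "y \<in> {tl (tl x)}"
    by (cases rule: sphere2_cases) auto
qed

lemma finite_sphere2: "finite (sphere2 n x)"
proof -
  have "sphere2 n x = {y \<in> sphere2 n x. length y = length x + 2} \<union> {y \<in> sphere2 n x. length y = length x + 1} \<union>
      {y \<in> sphere2 n x. length y = length x} \<union> {y \<in> sphere2 n x. length y + 1 = length x} \<union>
      {y \<in> sphere2 n x. length y + 2 = length x}"
  proof (rule equalityI; rule subsetI)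
    fix y assume y: "y \<in> sphere2 n x"
    then show "y \<in> {y \<in> sphere2 n x. length y = length x + 2} \<union> {y \<in> sphere2 n x. length y = length x + 1} \<union>
      {y \<in> sphere2 n x. length y = length x} \<union> {y \<in> sphere2 n x. length y + 1 = length x} \<union>
      {y \<in> sphere2 n x. length y + 2 = length x}"
      using sphere2_lengths[OF y] by simp linarith
  qed auto
  moreover have "finite \<dots>"
    by (intro finite_UnI; rule finite_subset[OF sphere2_up_2] finite_subset[OF sphere2_up_1]
        finite_subset[OF sphere2_same] finite_subset[OF sphere2_down_1] finite_subset[OF sphere2_down_2])
      (use fin in auto)
  ultimately show ?thesis by simp
qed

text \<open>All five level counts are given the common constant \<open>2 * N\<^sup>2\<close>, so
  that they can be summed uniformly.\<close>

lemma card_sphere2_up_2: "card {y \<in> sphere2 n x. length y = length x + 2} \<le> 2 * N\<^sup>2 * n\<^sup>2"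
proof -
  have "card {y \<in> sphere2 n x. length y = length x + 2} \<le> card ((V \<times> {1..n}) \<times> (V \<times> {1..n}))"
    by (rule surj_card_le[OF _ sphere2_up_2]) (use fin in auto)
  then show ?thesis by (simp add: card_cartesian_product power2_eq_square algebra_simps)
qed

lemma card_sphere2_up_1: "card {y \<in> sphere2 n x. length y = length x + 1} \<le> 2 * N\<^sup>2 * n"
proof -
  have "card {y \<in> sphere2 n x. length y = length x + 1} \<le> card ((\<lambda>a. a # x) ` (V \<times> {1..n}) \<union>
     (\<lambda>(a, v). a # (v, snd (hd x)) # tl x) ` ((V \<times> {1..n}) \<times> V))"
    by (rule card_mono[OF _ sphere2_up_1]) (use fin in auto)
  also have "\<dots> \<le> card (V \<times> {1..n}) + card ((V \<times> {1..n}) \<times> V)"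
    by (rule order_trans[OF card_Un_le]) (intro add_mono card_image_le; use fin in auto)
  also have "\<dots> = N * n + N\<^sup>2 * n"
    by (simp add: card_cartesian_product power2_eq_square algebra_simps)
  also have "\<dots> \<le> 2 * N\<^sup>2 * n"
    using mult_right_mono[OF N_le_N2, of n] by simp
  finally show ?thesis .
qed

lemma card_sphere2_same: "card {y \<in> sphere2 n x. length y = length x} \<le> 2 * N\<^sup>2 * n"
proof -
  have "card {y \<in> sphere2 n x. length y = length x} \<le> card (V \<times> {1..n})"
    by (rule surj_card_le[OF _ sphere2_same]) (use fin in auto)
  also have "\<dots> = N * n" by (simp add: card_cartesian_product)
  also have "\<dots> \<le> 2 * N\<^sup>2 * n"
    using mult_right_mono[OF N_le_N2, of n] unfolding mult.assoc by linarith
  finally show ?thesis .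
qed

lemma card_sphere2_down_1: "card {y \<in> sphere2 n x. length y + 1 = length x} \<le> 2 * N\<^sup>2"
proof -
  have "card {y \<in> sphere2 n x. length y + 1 = length x} \<le>
      card (insert (tl x) ((\<lambda>v. (v, snd (hd (tl x))) # tl (tl x)) ` V))"
    by (rule card_mono[OF _ sphere2_down_1]) (use fin in auto)
  also have "\<dots> \<le> Suc (card ((\<lambda>v. (v, snd (hd (tl x))) # tl (tl x)) ` V))"
    by (simp add: card_insert_le_m1 card_insert_if fin)
  also have "\<dots> \<le> Suc N" using card_image_le[OF fin] by simp
  also have "\<dots> \<le> 2 * N\<^sup>2" using N_pos N_le_N2 by simp
  finally show ?thesis .
qed

lemma card_sphere2_down_2: "card {y \<in> sphere2 n x. length y + 2 = length x} \<le> 2 * N\<^sup>2"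
proof -
  have "card {y \<in> sphere2 n x. length y + 2 = length x} \<le> 1"
    using card_mono[OF _ sphere2_down_2] by simp
  then show ?thesis using N_pos N_le_N2 by simp
qed

text \<open>This row sum is what bounds the operator in the weighted norm. The counts of order
  \<open>n\<^sup>2\<close>, \<open>n\<close>, \<open>n\<close>, 1, 1 at length changes 2, 1, 0, -1,
  -2 meet weights that differ by powers of \<open>sqrt n\<close>, and each product is at most
  \<open>b\<close>. Changes by 1 and -1 leave a factor \<open>sqrt n\<close> to spare.\<close>

lemma sphere2_weighted_sum:
  assumes "n \<ge> 1"
  shows "(\<Sum>y\<in>sphere2 n x. 1 / sqrt n ^ length y) \<le> 10 * (real N)\<^sup>2 * (n / sqrt n ^ length x)"
proof -
  define r where "r = sqrt n"
  have r: "r \<ge> 1" "real n = r\<^sup>2" using assms by (auto simp: r_def)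
  define L where "L = length x"
  define b where "b = 2 * (real N)\<^sup>2 * (r\<^sup>2 / r ^ L)"
  have "b \<ge> 0" using r by (simp add: b_def)
  have level: "card {y \<in> sphere2 n x. length y = l} / r ^ l \<le> b" if l: "l \<in> {L - 2..L + 2}" for l
  proof -
    have pos: "r ^ k > 0" for k using r by simp
    consider "l = L + 2" | "l = L + 1" | "l = L" | "l + 1 = L" | "l + 2 = L"
      using l by fastforce
    then show ?thesis
    proof cases
      case 1
      have "real (card {y \<in> sphere2 n x. length y = l}) \<le> real (2 * N\<^sup>2 * n\<^sup>2)"
        using card_sphere2_up_2[of n x] 1 unfolding L_def of_nat_le_iff by simp
      also have "\<dots> = b * r ^ l"
        using pos[of L] unfolding b_def 1 of_nat_mult of_nat_power r(2) 
        by (simp add: field_simps power2_eq_square power4_eq_xxxx)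
      finally show ?thesis using pos[of l] by (simp add: divide_le_eq)
    next
      case 2
      have "real (card {y \<in> sphere2 n x. length y = l}) \<le> real (2 * N\<^sup>2 * n)"
        using card_sphere2_up_1[of n x] 2 unfolding L_def of_nat_le_iff by simp
      also have "\<dots> = (2 * N\<^sup>2 * r\<^sup>2) * 1" using r by simp
      also have "\<dots> \<le> (2 * N\<^sup>2 * r\<^sup>2) * r"
        by (rule mult_left_mono) (use r in auto)
      also have "\<dots> = b * r ^ l"
        using pos[of L] unfolding b_def 2 by (simp add: field_simps)
      finally show ?thesis using pos[of l] by (simp add: divide_le_eq)
    next
      case 3
      have "real (card {y \<in> sphere2 n x. length y = l}) \<le> real (2 * N\<^sup>2 * n)"
        using card_sphere2_same[of n x] 3 unfolding L_def of_nat_le_iff by simp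
      also have "\<dots> = b * r ^ l"
        using pos[of L] unfolding b_def 3 of_nat_mult r(2) by simp
      finally show ?thesis using pos[of l] by (simp add: divide_le_eq)
    next
      case 4
      have "real (card {y \<in> sphere2 n x. length y = l}) \<le> real (2 * N\<^sup>2)"
        using card_sphere2_down_1[of n x] unfolding L_def[symmetric] 4[symmetric] of_nat_le_iff by simp
      also have "\<dots> \<le> 2 * N\<^sup>2 * r" using r by (simp add: mult_le_cancel_left1)
      also have "\<dots> = b * r ^ l"
        using pos[of l] r unfolding b_def 4[symmetric] by (simp add: field_simps power2_eq_square)
      finally show ?thesis using pos[of l] by (simp add: divide_le_eq)
    next
      case 5
      have "real (card {y \<in> sphere2 n x. length y = l}) \<le> real (2 * N\<^sup>2)"
        using card_sphere2_down_2[of n x] unfolding L_def[symmetric] 5[symmetric] of_nat_le_iff by simp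
      also have "\<dots> = b * r ^ l"
        using pos[of 1] unfolding b_def 5[symmetric] by (simp add: field_simps power2_eq_square)
      finally show ?thesis using pos[of l] by (simp add: divide_le_eq)
    qed
  qed
  have "(\<Sum>y\<in>sphere2 n x. 1 / r ^ length y) =
      (\<Sum>l\<in>{L - 2..L + 2}. \<Sum>y\<in>{y \<in> sphere2 n x. length y = l}. 1 / r ^ length y)"
    by (rule sum.group[symmetric]) (use finite_sphere2 sphere2_lengths in \<open>auto simp: L_def\<close>, force)
  also have "\<dots> = (\<Sum>l\<in>{L - 2..L + 2}. card {y \<in> sphere2 n x. length y = l} / r ^ l)"
    by (intro sum.cong) auto
  also have "\<dots> \<le> (\<Sum>l\<in>{L - 2..L + 2}. b)"
    by (rule sum_mono) (rule level)
  also have "\<dots> = card {L - 2..L + 2} * b" by simp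
  \<comment> \<open>Subtraction on naturals truncates \<open>L - 2\<close>, so there are at most
    five levels.\<close>
  also have "\<dots> \<le> 5 * b" by (rule mult_right_mono) (use \<open>b \<ge> 0\<close> in auto)
  finally show ?thesis unfolding b_def L_def[symmetric] r_def[symmetric] unfolding r(2) by simp
qed

section \<open>Neighbours at distance 2 among words in root neighbours\<close>

definition root_words :: "nat \<Rightarrow> nat \<Rightarrow> ('a \<times> nat) list set" where
  "root_words n j = {x \<in> X n. length x = j \<and> fst ` set x \<subseteq> root_nbrs}"

text \<open>The only candidate is \<open>tl (tl x)\<close>. It is reached by deleting two letters,
  which is possible exactly when both are root neighbours; then \<open>x\<close> itself is such a
  word.\<close>

lemma sphere2_root_words_down_2:
  assumes "x \<in> X n" "length x = j + 2"
  shows "card (sphere2 n x \<inter> root_words n j) = of_bool (x \<in> root_words n (j + 2))"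
proof (cases "x \<in> root_words n (j + 2)")
  case True
  then obtain v i w k u where x: "x = (v, i) # (w, k) # u"
    by (auto simp: root_words_def length_Suc_conv)
  have mem: "v \<in> root_nbrs" "w \<in> root_nbrs" "(w, k) # u \<in> X n" "u \<in> root_words n j"
    using True unfolding x root_words_def by (auto simp: Cons_in_X)
  have "adj n x ((w, k) # u)" "adj n ((w, k) # u) u"
    using mem assms unfolding x by (auto simp: adj_def up_step_def)
  moreover have "\<not> adj n x u" "x \<noteq> u"
    unfolding x adj_def up_step_def lev_step_def by (auto dest: arg_cong[of _ _ length])
  ultimately have "u \<in> sphere2 n x \<inter> root_words n j" using mem by (auto simp: sphere2_def)
  moreover have "sphere2 n x \<inter> root_words n j \<subseteq> {u}"
    using sphere2_down_2[of n x] assms(2) by (auto simp: root_words_def x)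
  ultimately have "sphere2 n x \<inter> root_words n j = {u}" by blast
  then show ?thesis using True by simp
next
  case False
  have "sphere2 n x \<inter> root_words n j = {}"
  proof (rule ccontr)
    assume "sphere2 n x \<inter> root_words n j \<noteq> {}"
    then obtain y where y: "y \<in> sphere2 n x" "y \<in> root_words n j" by blast
    from y(1) have "x \<in> root_words n (j + 2)"
      by (cases rule: sphere2_cases) (use y(2) assms in \<open>auto simp: root_words_def\<close>)
    with False show False by simp
  qed
  then show ?thesis using False by simp
qed

text \<open>The main term comes from deleting the first letter and prepending one of the \<sigma>
  root neighbours with a new index. At most two of the \<open>n\<close> indices are lost, an error
  of at most \<open>2 * \<sigma>\<close>. The empty word has no letter to delete, hence the guard on
  \<open>j\<close>; it becomes the rule that walks do not rest at 0.\<close>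

lemma sphere2_root_words_same:
  assumes "x \<in> X n" "length x = j"
  shows "\<bar>real (card (sphere2 n x \<inter> root_words n j)) - of_bool (j \<ge> 1 \<and> x \<in> root_words n j) * (real n * \<sigma>)\<bar> \<le> 2 * (real N)\<^sup>2"
proof (cases "j \<ge> 1 \<and> x \<in> root_words n j")
  case True
  then obtain v i u where x: "x = (v, i) # u"
    using assms(2) by (cases x) auto
  have mem: "v \<in> root_nbrs" "u \<in> X n" "fst ` set u \<subseteq> root_nbrs" "Suc (length u) = j"
    using True unfolding x root_words_def by (auto simp: Cons_in_X)
  \<comment> \<open>Keeping \<open>i\<close> could yield \<open>x\<close> or a neighbour of
    \<open>x\<close>, and the index of the next letter would break the alternation of indices. If
    \<open>u\<close> is empty, \<open>hd u\<close> is unspecified and excludes at most one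
    index.\<close>
  define I where "I = {1..n} - {i, snd (hd u)}"
  let ?f = "\<lambda>a. a # u"
  have "sphere2 n x \<inter> root_words n j \<subseteq> ?f ` (root_nbrs \<times> {1..n})"
  proof
    fix y assume "y \<in> sphere2 n x \<inter> root_words n j"
    then have y: "y \<in> {y \<in> sphere2 n x. length y = length x}" "y \<in> root_words n j" using assms by (auto simp: root_words_def)
    then obtain w k where "y = (w, k) # u" "k \<in> {1..n}"
      using sphere2_same[of n x] unfolding x by auto
    with y(2) show "y \<in> ?f ` (root_nbrs \<times> {1..n})" by (auto simp: root_words_def)
  qed
  from surj_card_le[OF _ this] have le: "card (sphere2 n x \<inter> root_words n j) \<le> \<sigma> * n"
    by (simp add: card_cartesian_product)
  have "?f ` (root_nbrs \<times> I) \<subseteq> sphere2 n x \<inter> root_words n j"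
  proof
    fix y assume "y \<in> ?f ` (root_nbrs \<times> I)"
    then obtain w k where y: "y = (w, k) # u" "w \<in> root_nbrs" "k \<in> I" by auto
    have yX: "y \<in> X n" using y mem root_nbrsD[OF y(2)] by (auto simp: Cons_in_X I_def)
    then have "adj n x u" "adj n u y"
      using assms mem y by (auto simp: adj_def up_step_def x)
    moreover have "\<not> adj n x y" "x \<noteq> y"
      using y unfolding x adj_def up_step_def lev_step_def I_def by auto
    ultimately show "y \<in> sphere2 n x \<inter> root_words n j"
      using yX y mem by (auto simp: sphere2_def root_words_def)
  qed
  then have "card (?f ` (root_nbrs \<times> I)) \<le> card (sphere2 n x \<inter> root_words n j)"
    by (intro card_mono) (auto simp: finite_sphere2)
  moreover have "card (?f ` (root_nbrs \<times> I)) = \<sigma> * card I"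
    by (subst card_image) (auto simp: inj_on_def card_cartesian_product)
  moreover have "card I \<ge> n - 2"
  proof -
    have "card {1..n} - card {i, snd (hd u)} \<le> card I"
      unfolding I_def by (intro diff_card_le_card_Diff) auto
    moreover have "card {i, snd (hd u)} \<le> 2" by (simp add: card_insert_if)
    ultimately show ?thesis by simp
  qed
  ultimately have ge: "\<sigma> * (n - 2) \<le> card (sphere2 n x \<inter> root_words n j)"
    by (metis mult_le_mono2 order_trans)
  have "real \<sigma> * (real n - 2) \<le> real \<sigma> * real (n - 2)"
    by (rule mult_left_mono) auto
  also have "\<dots> \<le> card (sphere2 n x \<inter> root_words n j)" using ge by (metis of_nat_mono of_nat_mult)
  finally have "real \<sigma> * (real n - 2) \<le> card (sphere2 n x \<inter> root_words n j)" .
  moreover have "real (card (sphere2 n x \<inter> root_words n j)) \<le> \<sigma> * real n"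
    using le by (metis of_nat_mono of_nat_mult)
  moreover have "real \<sigma> \<le> (real N)\<^sup>2"
    using sigma_le_N N_le_N2 by (metis of_nat_mono of_nat_power order_trans)
  moreover have "of_bool (j \<ge> 1 \<and> x \<in> root_words n j) = (1 :: real)" using True by simp
  ultimately show ?thesis
    unfolding abs_le_iff right_diff_distrib by (simp only: mult_1 mult.commute[of "real n"]) linarith
next
  case False
  \<comment> \<open>A down-up move into \<open>root_words n j\<close> would force
    \<open>j \<ge> 1\<close> and \<open>x \<in> root_words n j\<close>. Only level-level moves
    remain, and they keep the index.\<close>
  have "sphere2 n x \<inter> root_words n j \<subseteq> (\<lambda>v. (v, snd (hd x)) # tl x) ` V"
  proof
    fix y assume "y \<in> sphere2 n x \<inter> root_words n j"
    then have y: "y \<in> sphere2 n x" "y \<in> root_words n j" by auto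
    have yX: "y \<in> X n" using y by (simp add: root_words_def)
    from y(1) show "y \<in> (\<lambda>v. (v, snd (hd x)) # tl x) ` V"
      by (cases rule: sphere2_cases) (use y(2) yX assms False in \<open>auto simp: root_words_def Cons_in_X\<close>)
  qed
  from surj_card_le[OF fin this] have "card (sphere2 n x \<inter> root_words n j) \<le> 2 * N\<^sup>2"
    using N_le_N2 by simp
  then have "real (card (sphere2 n x \<inter> root_words n j)) \<le> real (2 * N\<^sup>2)" by (rule of_nat_mono)
  then show ?thesis using False by auto
qed

text \<open>Two root neighbours are prepended, and each new index avoids one value, so the count
  lies between \<open>(\<sigma> * (n - 1))\<^sup>2\<close> and
  \<open>(\<sigma> * n)\<^sup>2\<close>. If \<open>x\<close> has a letter that is not a root
  neighbour, so has every extension of \<open>x\<close>.\<close>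

lemma sphere2_root_words_up_2:
  assumes "x \<in> X n" "length x + 2 = j" "n \<ge> 1"
  shows "\<bar>real (card (sphere2 n x \<inter> root_words n j)) - of_bool (x \<in> root_words n (length x)) * (real n * \<sigma>)\<^sup>2\<bar>
    \<le> 2 * (real N)\<^sup>2 * n"
proof (cases "x \<in> root_words n (length x)")
  case True
  then have mem: "x \<in> X n" "fst ` set x \<subseteq> root_nbrs" by (auto simp: root_words_def)
  define I where "I = (\<lambda>k. {1..n} - {k})"
  let ?f = "\<lambda>(a, b). b # a # x"
  have "sphere2 n x \<inter> root_words n j \<subseteq> ?f ` ((root_nbrs \<times> {1..n}) \<times> (root_nbrs \<times> {1..n}))"
  proof
    fix y assume "y \<in> sphere2 n x \<inter> root_words n j"
    then have y: "y \<in> {y \<in> sphere2 n x. length y = length x + 2}" "y \<in> root_words n j"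
      using assms by (auto simp: root_words_def)
    then obtain w k v i where "y = (w, k) # (v, i) # x" "k \<in> {1..n}" "i \<in> {1..n}"
      using sphere2_up_2[of n x] by auto
    with y(2) show "y \<in> ?f ` ((root_nbrs \<times> {1..n}) \<times> (root_nbrs \<times> {1..n}))"
      by (auto simp: root_words_def image_iff)
  qed
  from surj_card_le[OF _ this] have le: "card (sphere2 n x \<inter> root_words n j) \<le> (n * \<sigma>)\<^sup>2"
    by (simp add: card_cartesian_product power2_eq_square mult_ac)
  \<comment> \<open>\<open>a\<close> is the inner letter, next to \<open>x\<close>; the outer index
    must avoid that of \<open>a\<close>, so the choices form a dependent sum.\<close>
  let ?S = "SIGMA a:(root_nbrs \<times> I (snd (hd x))). root_nbrs \<times> I (snd a)"
  have "?f ` ?S \<subseteq> sphere2 n x \<inter> root_words n j"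
  proof
    fix y assume "y \<in> ?f ` ?S"
    then obtain w k v i where y: "y = (w, k) # (v, i) # x" "w \<in> root_nbrs" "v \<in> root_nbrs"
        "i \<in> I (snd (hd x))" "k \<in> I i" by auto
    have yX: "y \<in> X n" using y mem root_nbrsD[OF y(2)] root_nbrsD[OF y(3)]
      by (auto simp: Cons_in_X I_def)
    then have "adj n x ((v, i) # x)" "adj n ((v, i) # x) y"
      using y by (auto simp: adj_def up_step_def Cons_in_X)
    moreover have "\<not> adj n x y" "x \<noteq> y"
      using y unfolding adj_def up_step_def lev_step_def by (auto dest: arg_cong[of _ _ length])
    ultimately show "y \<in> sphere2 n x \<inter> root_words n j"
      using yX y mem assms by (auto simp: sphere2_def root_words_def)
  qed
  then have "card (?f ` ?S) \<le> card (sphere2 n x \<inter> root_words n j)"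
    by (intro card_mono) (auto simp: finite_sphere2)
  moreover have "card (?f ` ?S) = card ?S"
    by (rule card_image) (auto simp: inj_on_def)
  moreover have "card (I k) \<ge> n - 1" for k
  proof -
    have "card {1..n} - card {k} \<le> card (I k)"
      unfolding I_def by (intro diff_card_le_card_Diff) auto
    then show ?thesis by simp
  qed note I = this
  moreover have "card ?S \<ge> (\<sigma> * (n - 1)) * (\<sigma> * (n - 1))"
  proof -
    have "(\<sigma> * (n - 1)) * (\<sigma> * (n - 1)) \<le> card (root_nbrs \<times> I (snd (hd x))) * (\<sigma> * (n - 1))"
      using I by (simp add: card_cartesian_product)
    also have "\<dots> = (\<Sum>a\<in>root_nbrs \<times> I (snd (hd x)). \<sigma> * (n - 1))" by simp
    also have "\<dots> \<le> (\<Sum>a\<in>root_nbrs \<times> I (snd (hd x)). card (root_nbrs \<times> I (snd a)))"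
      using I by (intro sum_mono) (simp add: card_cartesian_product)
    also have "\<dots> = card ?S"
      by (rule card_SigmaI[symmetric]) (auto simp: I_def)
    finally show ?thesis .
  qed
  ultimately have ge: "(\<sigma> * (n - 1)) * (\<sigma> * (n - 1)) \<le> card (sphere2 n x \<inter> root_words n j)" by linarith
  have "real ((\<sigma> * (n - 1)) * (\<sigma> * (n - 1))) \<le> card (sphere2 n x \<inter> root_words n j)"
    using ge by (rule of_nat_mono)
  then have "(real \<sigma>)\<^sup>2 * (real n - 1)\<^sup>2 \<le> card (sphere2 n x \<inter> root_words n j)"
    using assms(3) by (simp add: of_nat_diff power2_eq_square mult_ac)
  moreover have "(real \<sigma>)\<^sup>2 * (real n - 1)\<^sup>2 \<ge> (real n * \<sigma>)\<^sup>2 - 2 * (real \<sigma>)\<^sup>2 * n"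
    by (simp add: power2_eq_square algebra_simps)
  moreover have "2 * (real \<sigma>)\<^sup>2 * n \<le> 2 * (real N)\<^sup>2 * n"
    using sigma_le_N by (intro mult_right_mono mult_left_mono power_mono) auto
  moreover have "real (card (sphere2 n x \<inter> root_words n j)) \<le> (real n * \<sigma>)\<^sup>2"
    using of_nat_mono[OF le] by simp
  ultimately show ?thesis using True by simp
next
  case False
  have "sphere2 n x \<inter> root_words n j = {}"
  proof (rule ccontr)
    assume "sphere2 n x \<inter> root_words n j \<noteq> {}"
    then obtain y where y: "y \<in> {y \<in> sphere2 n x. length y = length x + 2}" "y \<in> root_words n j"
      using assms(2) by (auto simp: root_words_def)
    then obtain a b where "y = a # b # x" using sphere2_up_2[of n x] by auto
    with y(2) have "x \<in> root_words n (length x)" using assms(1) by (auto simp: root_words_def)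
    with False show False by simp
  qed
  then show ?thesis using False by simp
qed

text \<open>Main terms arise at lengths \<open>j + 2\<close>, \<open>j\<close> and
  \<open>j - 2\<close>; everything at lengths \<open>j + 1\<close> and \<open>j - 1\<close> is
  error. With \<open>r = sqrt n\<close> and \<open>C = 2 * (real N)\<^sup>2\<close>, the weighted
  errors at lengths \<open>j + 2\<close> down to \<open>j - 2\<close> are 0,
  \<open>C * r ^ (j + 1)\<close>, \<open>C * r ^ j\<close>, \<open>C * r ^ (j + 1)\<close> and
  \<open>C * r ^ j\<close>, one factor \<open>r\<close> below the scale \<open>r ^ (j + 2)\<close>
  of the main terms. The guard \<open>j \<ge> 2\<close> keeps truncated subtraction from producing a
  false term.\<close>

lemma card_sphere2_root_words_approx:
  assumes "x \<in> X n" "n \<ge> 1"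
  shows "\<bar>real (card (sphere2 n x \<inter> root_words n j)) - of_bool (x \<in> root_words n (j + 2))
      - of_bool (j \<ge> 1 \<and> x \<in> root_words n j) * (real n * \<sigma>)
      - of_bool (j \<ge> 2 \<and> x \<in> root_words n (j - 2)) * (real n * \<sigma>)\<^sup>2\<bar> * sqrt n ^ length x
    \<le> 2 * (real N)\<^sup>2 * sqrt n ^ (j + 1)" (is "\<bar>?d\<bar> * _ \<le> _")
proof -
  define r where "r = sqrt n"
  have r: "r \<ge> 1" "real n = r\<^sup>2" using assms by (auto simp: r_def)
  define C where "C = 2 * (real N)\<^sup>2"
  have C: "C \<ge> 0" by (simp add: C_def)
  have root_words_len: "x \<in> root_words n k \<Longrightarrow> length x = k" for k by (simp add: root_words_def)
  have sub: "sphere2 n x \<inter> root_words n j \<subseteq> {y \<in> sphere2 n x. length y = j}" by (auto simp: root_words_def)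
  have fin_lev: "finite {y \<in> sphere2 n x. length y = j}" using finite_sphere2 by simp
  have le: "card (sphere2 n x \<inter> root_words n j) \<le> card {y \<in> sphere2 n x. length y = j}"
    by (rule card_mono[OF fin_lev sub])
  consider "length x = j + 2" | "length x = j + 1" | "length x = j" | "length x + 1 = j"
    | "length x + 2 = j" | "length x + 2 < j \<or> j + 2 < length x" by linarith
  then have "\<bar>?d\<bar> * r ^ length x \<le> C * r ^ (j + 1)"
  proof cases
    case 1
    then have "?d = 0" using sphere2_root_words_down_2[OF assms(1) 1] root_words_len[of j] root_words_len[of "j - 2"] by auto
    then show ?thesis using C r by simp
  next
    case 2
    then have d: "?d = real (card (sphere2 n x \<inter> root_words n j))"
      using root_words_len[of j] root_words_len[of "j + 2"] root_words_len[of "j - 2"] by auto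
    have "card (sphere2 n x \<inter> root_words n j) \<le> 2 * N\<^sup>2"
      using le card_sphere2_down_1[of n x] 2 by simp
    from of_nat_mono[OF this, where 'a = real] have "\<bar>?d\<bar> \<le> C" unfolding d by (simp add: C_def)
    then show ?thesis using r unfolding 2 by (intro mult_right_mono) auto
  next
    case 3
    then have d: "?d = real (card (sphere2 n x \<inter> root_words n j)) - of_bool (j \<ge> 1 \<and> x \<in> root_words n j) * (real n * \<sigma>)"
      using root_words_len[of "j + 2"] root_words_len[of "j - 2"] by auto
    have "\<bar>?d\<bar> \<le> C" unfolding d C_def by (rule sphere2_root_words_same[OF assms(1) 3])
    then show ?thesis using r C unfolding 3 by (intro mult_mono power_increasing) auto
  next
    case 4
    then have d: "?d = real (card (sphere2 n x \<inter> root_words n j))"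
      using root_words_len[of j] root_words_len[of "j + 2"] root_words_len[of "j - 2"] by auto
    have "card (sphere2 n x \<inter> root_words n j) \<le> 2 * N\<^sup>2 * n"
      using le card_sphere2_up_1[of n x] 4 by simp
    from of_nat_mono[OF this, where 'a = real] have "\<bar>?d\<bar> \<le> C * r\<^sup>2"
      unfolding d by (simp add: C_def r)
    then have "\<bar>?d\<bar> * r ^ length x \<le> C * r\<^sup>2 * r ^ length x"
      using r by (intro mult_right_mono) auto
    also have "\<dots> = C * r ^ (j + 1)" using 4 by (auto simp: power2_eq_square)
    finally show ?thesis .
  next
    case 5
    then have d: "?d = real (card (sphere2 n x \<inter> root_words n j)) - of_bool (x \<in> root_words n (length x)) * (real n * \<sigma>)\<^sup>2"
      using root_words_len[of "j + 2"] root_words_len[of j] by auto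
    have "\<bar>?d\<bar> \<le> C * r\<^sup>2"
      unfolding d C_def r(2)[symmetric] by (rule sphere2_root_words_up_2[OF assms(1) 5 assms(2)])
    then have "\<bar>?d\<bar> * r ^ length x \<le> C * r\<^sup>2 * r ^ length x"
      using r by (intro mult_right_mono) auto
    also have "\<dots> = C * r ^ j" using 5 by (auto simp: power2_eq_square)
    also have "\<dots> \<le> C * r ^ (j + 1)"
      using r C by (intro mult_left_mono power_increasing) auto
    finally show ?thesis .
  next
    case 6
    then have "{y \<in> sphere2 n x. length y = j} = {}" by (auto dest: sphere2_lengths)
    then have "sphere2 n x \<inter> root_words n j = {}" using sub by blast
    then have "?d = 0" using 6 root_words_len[of j] root_words_len[of "j + 2"] root_words_len[of "j - 2"] by auto
    then show ?thesis using C r by simp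
  qed
  then show ?thesis by (simp add: r_def C_def)
qed

section \<open>The normalised operator and its action on the layers\<close>

definition dist2_op :: "nat \<Rightarrow> (('a \<times> nat) list \<Rightarrow> real) \<Rightarrow> ('a \<times> nat) list \<Rightarrow> real" where
  "dist2_op n F x = inverse (real n * \<sigma>) * (\<Sum>y\<in>sphere2 n x. F y)"

lemma dist2_op_pow_linear:
  "(dist2_op n ^^ m) (\<lambda>x. a * F x + b * G x) = (\<lambda>x. a * (dist2_op n ^^ m) F x + b * (dist2_op n ^^ m) G x)"
proof (induction m)
  case (Suc m)
  then show ?case
    by (simp add: dist2_op_def sum.distrib sum_distrib_left algebra_simps fun_eq_iff)
qed simp

text \<open>Bounding \<open>F\<close> by \<open>K\<close> over the weight reduces this to
  \<open>sphere2_weighted_sum\<close>; the factor \<open>n\<close> there cancels against the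
  normalisation, and \<open>inverse \<sigma> \<le> 1\<close>.\<close>

lemma dist2_op_bounded:
  assumes "n \<ge> 1" "\<sigma> \<ge> 1" "K \<ge> 0" "x \<in> X n"
    and F: "\<And>y. y \<in> X n \<Longrightarrow> \<bar>F y\<bar> * sqrt n ^ length y \<le> K"
  shows "\<bar>dist2_op n F x\<bar> * sqrt n ^ length x \<le> 10 * (real N)\<^sup>2 * K"
proof -
  have pos: "sqrt n ^ k > 0" for k using assms by simp
  have "\<bar>\<Sum>y\<in>sphere2 n x. F y\<bar> \<le> (\<Sum>y\<in>sphere2 n x. \<bar>F y\<bar>)" by (rule sum_abs)
  also have "\<dots> \<le> (\<Sum>y\<in>sphere2 n x. K * (1 / sqrt n ^ length y))"
    using F sphere2_in_X pos by (intro sum_mono) (simp add: field_simps)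
  also have "\<dots> = K * (\<Sum>y\<in>sphere2 n x. 1 / sqrt n ^ length y)" by (simp add: sum_distrib_left)
  also have "\<dots> \<le> K * (10 * (real N)\<^sup>2 * (n / sqrt n ^ length x))"
    by (rule mult_left_mono[OF sphere2_weighted_sum]) (use assms in auto)
  finally have "\<bar>\<Sum>y\<in>sphere2 n x. F y\<bar> * sqrt n ^ length x \<le> 10 * (real N)\<^sup>2 * K * n"
    using pos[of "length x"] by (simp add: field_simps)
  then have "inverse (real n * \<sigma>) * (\<bar>\<Sum>y\<in>sphere2 n x. F y\<bar> * sqrt n ^ length x) \<le>
      inverse (real n * \<sigma>) * (10 * (real N)\<^sup>2 * K * n)"
    by (rule mult_left_mono) simp
  then have "\<bar>dist2_op n F x\<bar> * sqrt n ^ length x \<le> inverse (real n * \<sigma>) * (10 * (real N)\<^sup>2 * K * n)"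
    by (simp add: dist2_op_def abs_mult mult.assoc)
  also have "\<dots> = 10 * (real N)\<^sup>2 * K * inverse \<sigma>"
    using assms by (simp add: field_simps)
  also have "\<dots> \<le> 10 * (real N)\<^sup>2 * K * 1"
    using assms by (intro mult_left_mono) (auto simp: inverse_le_1_iff)
  finally show ?thesis by simp
qed

lemma dist2_op_pow_bounded:
  assumes "n \<ge> 1" "\<sigma> \<ge> 1" "K \<ge> 0"
    and F: "\<And>y. y \<in> X n \<Longrightarrow> \<bar>F y\<bar> * sqrt n ^ length y \<le> K"
    and "x \<in> X n"
  shows "\<bar>(dist2_op n ^^ m) F x\<bar> * sqrt n ^ length x \<le> (10 * (real N)\<^sup>2) ^ m * K"
  using \<open>x \<in> X n\<close>
proof (induction m arbitrary: x)
  case (Suc m)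
  have "\<bar>dist2_op n ((dist2_op n ^^ m) F) x\<bar> * sqrt n ^ length x \<le> 10 * (real N)\<^sup>2 * ((10 * (real N)\<^sup>2) ^ m * K)"
    by (rule dist2_op_bounded) (use Suc assms in auto)
  then show ?case by simp
qed (use F in auto)

definition layer :: "nat \<Rightarrow> nat \<Rightarrow> ('a \<times> nat) list \<Rightarrow> real" where
  "layer n k x = of_bool (x \<in> root_words n (2 * k)) / (real n * \<sigma>) ^ k"

text \<open>Take \<open>j = 2 * k\<close> in the counting estimate and divide by
  \<open>q ^ Suc k\<close>. The main terms 1, \<open>q\<close>, \<open>q\<^sup>2\<close> become the
  coefficients 1 of the layers \<open>k + 1\<close>, \<open>k\<close>, \<open>k - 1\<close>, and the
  error of order \<open>sqrt n ^ (2 * k + 1)\<close> is divided by at least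
  \<open>n ^ Suc k\<close>.\<close>

lemma dist2_op_layer_approx:
  assumes "x \<in> X n" "n \<ge> 1" "\<sigma> \<ge> 1"
  shows "\<bar>dist2_op n (layer n k) x - (layer n (Suc k) x + of_bool (k \<ge> 1) * (layer n k x + layer n (k - 1) x))\<bar>
    * sqrt n ^ length x \<le> 2 * (real N)\<^sup>2 / sqrt n"
proof -
  define q where "q = real n * \<sigma>"
  have q: "q > 0" using assms by (simp add: q_def)
  have r: "sqrt n > 0" using assms by simp
  define d where "d = real (card (sphere2 n x \<inter> root_words n (2 * k))) - of_bool (x \<in> root_words n (2 * k + 2))
      - of_bool (2 * k \<ge> 1 \<and> x \<in> root_words n (2 * k)) * q
      - of_bool (2 * k \<ge> 2 \<and> x \<in> root_words n (2 * k - 2)) * q\<^sup>2"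
  have "(\<Sum>y\<in>sphere2 n x. layer n k y) = (\<Sum>y\<in>sphere2 n x \<inter> root_words n (2 * k). 1 / q ^ k)"
    unfolding layer_def q_def by (rule sum.mono_neutral_cong_right) (auto simp: finite_sphere2)
  then have Tg: "dist2_op n (layer n k) x = card (sphere2 n x \<inter> root_words n (2 * k)) / q ^ Suc k"
    unfolding dist2_op_def q_def[symmetric] by (simp add: field_simps)
  have "dist2_op n (layer n k) x - (layer n (Suc k) x + of_bool (k \<ge> 1) * (layer n k x + layer n (k - 1) x)) = d / q ^ Suc k"
  proof (cases k)
    case 0
    then show ?thesis unfolding Tg layer_def q_def[symmetric] d_def by (simp add: diff_divide_distrib numeral_2_eq_2)
  next
    case (Suc k')
    then show ?thesis unfolding Tg layer_def q_def[symmetric] d_def using q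
      by (simp add: field_simps power2_eq_square)
  qed
  then have "\<bar>dist2_op n (layer n k) x - (layer n (Suc k) x + of_bool (k \<ge> 1) * (layer n k x + layer n (k - 1) x))\<bar>
      * sqrt n ^ length x = \<bar>d\<bar> * sqrt n ^ length x / q ^ Suc k"
    using q by (simp add: abs_divide)
  also have "\<dots> \<le> 2 * (real N)\<^sup>2 * sqrt n ^ (2 * k + 1) / q ^ Suc k"
    using card_sphere2_root_words_approx[OF assms(1,2), of "2 * k"] q
    unfolding q_def[symmetric] d_def by (intro divide_right_mono) auto
  also have "\<dots> \<le> 2 * (real N)\<^sup>2 * sqrt n ^ (2 * k + 1) / real n ^ Suc k"
    using assms unfolding q_def
    by (intro divide_left_mono power_mono mult_pos_pos zero_less_power) auto
  also have "real n ^ Suc k = sqrt n ^ (2 * k + 1) * sqrt n"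
    by (metis Suc_eq_plus1 add_Suc_right mult_Suc_right mult.commute numeral_2_eq_2 of_nat_0_le_iff
        plus_1_eq_Suc power_Suc power_mult real_sqrt_pow2 add.commute mult_2)
  also have "2 * (real N)\<^sup>2 * sqrt n ^ (2 * k + 1) / (sqrt n ^ (2 * k + 1) * sqrt n) =
      2 * (real N)\<^sup>2 / sqrt n"
    using r by simp
  finally show ?thesis .
qed

text \<open>The innermost application of the operator is expanded on the layer. Its error is small
  in the weighted norm, and the remaining \<open>m\<close> applications enlarge it by a constant
  factor only. The other terms follow the recursion of \<open>riordan\<close>, which moves
  \<open>k\<close>, so \<open>k\<close> is arbitrary in the induction.\<close>

lemma dist2_op_pow_layer_at_root:
  assumes "\<sigma> \<ge> 1"
  shows "\<exists>K. \<forall>n\<ge>1. \<bar>(dist2_op n ^^ m) (layer n k) [] - riordan m k\<bar> \<le> K / sqrt n"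
proof (induction m arbitrary: k)
  case 0
  have "layer n k [] = of_bool (k = 0)" for n
    by (cases k) (auto simp: layer_def root_words_def)
  then show ?case by (auto intro: exI[of _ 0])
next
  case (Suc m)
  obtain K1 where K1: "\<And>n. n \<ge> 1 \<Longrightarrow> \<bar>(dist2_op n ^^ m) (layer n (Suc k)) [] - riordan m (Suc k)\<bar> \<le> K1 / sqrt n"
    using Suc by blast
  obtain K2 where K2: "\<And>n. n \<ge> 1 \<Longrightarrow> \<bar>(dist2_op n ^^ m) (layer n k) [] - riordan m k\<bar> \<le> K2 / sqrt n"
    using Suc by blast
  obtain K3 where K3: "\<And>n. n \<ge> 1 \<Longrightarrow> \<bar>(dist2_op n ^^ m) (layer n (k - 1)) [] - riordan m (k - 1)\<bar> \<le> K3 / sqrt n"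
    using Suc by blast
  define K0 where "K0 = (10 * (real N)\<^sup>2) ^ m * (2 * (real N)\<^sup>2)"
  define c :: real where "c = of_bool (k \<ge> 1)"
  have "\<bar>(dist2_op n ^^ Suc m) (layer n k) [] - riordan (Suc m) k\<bar> \<le> (K0 + K1 + c * (K2 + K3)) / sqrt n"
    if n: "n \<ge> 1" for n
  proof -
    define err where "err = (\<lambda>x. dist2_op n (layer n k) x - (layer n (Suc k) x + c * (layer n k x + layer n (k - 1) x)))"
    \<comment> \<open>The empty word has weight 1, so the norm bound is a bound on the value
      there.\<close>
    have "\<bar>(dist2_op n ^^ m) err []\<bar> * sqrt n ^ length ([] :: ('a \<times> nat) list) \<le>
        (10 * (real N)\<^sup>2) ^ m * (2 * (real N)\<^sup>2 / sqrt n)"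
      unfolding err_def c_def
      by (rule dist2_op_pow_bounded[OF n assms]) (use dist2_op_layer_approx n assms in auto)
    then have err_le: "\<bar>(dist2_op n ^^ m) err []\<bar> \<le> K0 / sqrt n" by (simp add: K0_def)
    have "dist2_op n (layer n k) = (\<lambda>x. 1 * err x + 1 * (1 * layer n (Suc k) x + c * (1 * layer n k x + 1 * layer n (k - 1) x)))"
      by (simp add: err_def)
    then have "(dist2_op n ^^ m) (dist2_op n (layer n k)) [] = (dist2_op n ^^ m) err [] + (dist2_op n ^^ m) (layer n (Suc k)) [] +
        c * ((dist2_op n ^^ m) (layer n k) [] + (dist2_op n ^^ m) (layer n (k - 1)) [])"
      by (simp only: dist2_op_pow_linear) simp
    then have eq: "(dist2_op n ^^ Suc m) (layer n k) [] - riordan (Suc m) k = (dist2_op n ^^ m) err [] +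
        ((dist2_op n ^^ m) (layer n (Suc k)) [] - riordan m (Suc k)) +
        c * (((dist2_op n ^^ m) (layer n k) [] - riordan m k) + ((dist2_op n ^^ m) (layer n (k - 1)) [] - riordan m (k - 1)))"
      unfolding funpow_Suc_right comp_apply riordan.simps c_def by (simp add: algebra_simps)
    have c01: "c = 0 \<or> c = 1" by (auto simp: c_def)
    show ?thesis unfolding eq add_divide_distrib
      using c01
    proof (elim disjE)
      assume c: "c = 0"
      show "\<bar>(dist2_op n ^^ m) err [] + ((dist2_op n ^^ m) (layer n (Suc k)) [] - riordan m (Suc k)) +
          c * (((dist2_op n ^^ m) (layer n k) [] - riordan m k) + ((dist2_op n ^^ m) (layer n (k - 1)) [] - riordan m (k - 1)))\<bar>
          \<le> K0 / sqrt n + K1 / sqrt n + c * (K2 + K3) / sqrt n"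
        unfolding c using err_le K1[OF n] by simp
    next
      assume c: "c = 1"
      show "\<bar>(dist2_op n ^^ m) err [] + ((dist2_op n ^^ m) (layer n (Suc k)) [] - riordan m (Suc k)) +
          c * (((dist2_op n ^^ m) (layer n k) [] - riordan m k) + ((dist2_op n ^^ m) (layer n (k - 1)) [] - riordan m (k - 1)))\<bar>
          \<le> K0 / sqrt n + K1 / sqrt n + c * (K2 + K3) / sqrt n"
        unfolding c mult_1 add_divide_distrib using err_le K1[OF n] K2[OF n] K3[OF n] by linarith
    qed
  qed
  then show ?case by blast
qed

section \<open>Vacuum moments as powers of the operator\<close>

text \<open>\<open>matrix_power\<close> builds the root's row by multiplying on the right, whereas
  \<open>dist2_op\<close> acts on functions from the left. The matrix is symmetric, so both follow
  the same recursion, starting from the indicator of the empty word, which is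
  \<open>layer n 0\<close>.\<close>

lemma vacuum_moment_eq:
  "vacuum_moment (X n) [] (\<lambda>x y. inverse (real n * \<sigma>) *
     adjacency_matrix (distance_edges 2 (X n) (free_power_edges V E e n)) x y) m = (dist2_op n ^^ m) (layer n 0) []"
proof -
  let ?M = "\<lambda>x y. inverse (real n * \<sigma>) *
     adjacency_matrix (distance_edges 2 (X n) (free_power_edges V E e n)) x y"
  have "matrix_power (X n) ?M m [] y = (dist2_op n ^^ m) (layer n 0) y" if "y \<in> X n" for y
    using that
  proof (induction m arbitrary: y)
    case 0
    then show ?case by (auto simp: layer_def root_words_def)
  next
    case (Suc m)
    \<comment> \<open>Column \<open>y\<close> of the matrix is supported on the finite set
      \<open>sphere2 n y\<close>, so the infinite sum is a finite one.\<close>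
    have "matrix_power (X n) ?M (Suc m) [] y =
        (\<Sum>\<^sub>\<infinity>z\<in>sphere2 n y. (dist2_op n ^^ m) (layer n 0) z * inverse (real n * \<sigma>))"
      unfolding matrix_power.simps
      by (rule infsum_cong_neutral)
        (use sphere2_in_X sphere2_sym Suc in \<open>auto simp: adjacency_matrix_def sphere2_iff\<close>)
    also have "\<dots> = dist2_op n ((dist2_op n ^^ m) (layer n 0)) y"
      by (simp add: finite_sphere2 dist2_op_def sum_distrib_left mult.commute)
    finally show ?case by simp
  qed
  then show ?thesis unfolding vacuum_moment_def by simp
qed

lemma vacuum_moment_tendsto:
  assumes "\<sigma> \<ge> 1"
  shows "(\<lambda>n. vacuum_moment (X n) [] (\<lambda>x y. inverse (real n * \<sigma>) *
     adjacency_matrix (distance_edges 2 (X n) (free_power_edges V E e n)) x y) m)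
    \<longlonglongrightarrow> riordan m 0"
proof -
  obtain K where K: "\<And>n. n \<ge> 1 \<Longrightarrow> \<bar>(dist2_op n ^^ m) (layer n 0) [] - riordan m 0\<bar> \<le> K / sqrt n"
    using dist2_op_pow_layer_at_root[OF assms, of m 0] by blast
  have "(\<lambda>n. (dist2_op n ^^ m) (layer n 0) [] - riordan m 0) \<longlonglongrightarrow> 0"
  proof (rule Lim_null_comparison)
    show "\<forall>\<^sub>F n in sequentially. norm ((dist2_op n ^^ m) (layer n 0) [] - riordan m 0) \<le> K / sqrt (real n)"
      using eventually_ge_at_top[of 1] by eventually_elim (use K in simp)
    show "(\<lambda>n. K / sqrt (real n)) \<longlonglongrightarrow> 0"
      by (intro tendsto_divide_0[OF tendsto_const] filterlim_at_top_imp_at_infinity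
          filterlim_compose[OF sqrt_at_top filterlim_real_sequentially])
  qed
  then show ?thesis unfolding vacuum_moment_eq by (simp add: LIM_zero_iff)
qed

end

section \<open>Chebyshev polynomials and the semicircle density\<close>

text \<open>\<open>chebyshev_S j x\<close> is \<open>U\<^sub>j(x/2)\<close>, with \<open>U\<^sub>j\<close> the Chebyshev polynomial of the second kind.\<close>

fun chebyshev_S :: "nat \<Rightarrow> real \<Rightarrow> real" where
  "chebyshev_S 0 x = 1"
| "chebyshev_S (Suc 0) x = x"
| "chebyshev_S (Suc (Suc j)) x = x * chebyshev_S (Suc j) x - chebyshev_S j x"

text \<open>The recursion turns into \<open>2 * cos t * sin a = sin (a + t) + sin (a - t)\<close>.
  The factor \<open>sin t\<close> stays on the left to avoid dividing at its zeros.\<close>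

lemma chebyshev_S_cos: "sin t * chebyshev_S j (2 * cos t) = sin (real (Suc j) * t)"
proof (induction j "2 * cos t" rule: chebyshev_S.induct)
  case 2
  have "real (Suc (Suc 0)) * t = 2 * t" by simp
  then show ?case by (simp only: chebyshev_S.simps sin_double)
next
  case (3 j)
  have "sin t * chebyshev_S (Suc (Suc j)) (2 * cos t) =
      2 * cos t * (sin t * chebyshev_S (Suc j) (2 * cos t)) - sin t * chebyshev_S j (2 * cos t)"
    by (simp add: algebra_simps)
  also have "\<dots> = 2 * cos t * sin (real (Suc (Suc j)) * t) - sin (real (Suc j) * t)"
    unfolding 3 by (rule refl)
  also have "\<dots> = sin (real (Suc (Suc j)) * t + t)"
  proof -
    have "2 * cos t * sin a - sin (a - t) = sin (a + t)" for a :: real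
      by (simp add: sin_add sin_diff)
    moreover have "real (Suc j) * t = real (Suc (Suc j)) * t - t" by (simp add: algebra_simps)
    ultimately show ?thesis by simp
  qed
  also have "real (Suc (Suc j)) * t + t = real (Suc (Suc (Suc j))) * t" by (simp add: algebra_simps)
  finally show ?case .
qed simp

lemma continuous_on_chebyshev_S [continuous_intros]:
  "continuous_on S f \<Longrightarrow> continuous_on S (\<lambda>x. chebyshev_S j (f x))"
  by (induction j "0::real" rule: chebyshev_S.induct) (auto intro!: continuous_intros)

lemma chebyshev_S_measurable [measurable]: "chebyshev_S j \<in> borel_measurable borel"
  by (intro borel_measurable_continuous_onI continuous_intros)

text \<open>Applying the three-term recursion twice gives the middle term of
  \<open>x\<^sup>2 * chebyshev_S (2 * k) x\<close> coefficient 2 for \<open>k \<ge> 1\<close> and 1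
  for \<open>k = 0\<close>; subtracting 1 leaves 1 and 0, as in \<open>riordan\<close>.\<close>

lemma chebyshev_S_mult:
  "(x\<^sup>2 - 1) * chebyshev_S (2 * k) x =
     chebyshev_S (2 * Suc k) x + of_bool (k \<ge> 1) * (chebyshev_S (2 * k) x + chebyshev_S (2 * (k - 1)) x)"
  by (cases k) (auto simp: power2_eq_square algebra_simps)

lemma chebyshev_S_has_integral_0:
  assumes "j \<ge> 1"
  shows "((\<lambda>x. chebyshev_S j x * sqrt (4 - x\<^sup>2)) has_integral 0) {-2..2}"
proof -
  \<comment> \<open>Substituting \<open>x = 2 * cos t\<close> turns the integrand into
    \<open>- 4 * sin ((j + 1) * t) * sin t\<close>, that is
    \<open>- 2 * (cos (j * t) - cos ((j + 2) * t))\<close>; \<open>H\<close> is its primitive in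
    \<open>t\<close>, written in \<open>x\<close>.\<close>
  define H where "H = (\<lambda>x. - 2 * (sin (j * arccos (x / 2)) / j -
    sin (real (j + 2) * arccos (x / 2)) / real (j + 2)))"
  \<comment> \<open>\<open>arccos\<close> is not differentiable at the ends of its domain, so the
    derivative is computed in the interior and \<open>H\<close> is only continuous up to the
    boundary.\<close>
  have "((\<lambda>x. chebyshev_S j x * sqrt (4 - x\<^sup>2)) has_integral (H 2 - H (-2))) {-2..2}"
  proof (rule fundamental_theorem_of_calculus_interior)
    show "continuous_on {-2..2} H"
      unfolding H_def using assms by (intro continuous_intros) auto
    fix x :: real assume x: "x \<in> {-2<..<2}"
    define t where "t = arccos (x / 2)"
    have xt: "x = 2 * cos t" using x by (simp add: t_def cos_arccos)
    have st: "sin t = sqrt (1 - (x / 2)\<^sup>2)"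
      unfolding t_def using x by (intro sin_arccos) auto
    have quarter: "1 - (x / 2)\<^sup>2 = (4 - x\<^sup>2) / 4" by (simp add: power2_eq_square)
    have root: "sqrt (4 - x\<^sup>2) = 2 * sin t" unfolding st quarter by (simp add: real_sqrt_divide)
    have "x\<^sup>2 < 2\<^sup>2" using x by (intro abs_square_less_1[THEN iffD2] power2_strict_mono) auto
    then have pos: "sin t > 0" unfolding st by (simp add: power2_eq_square)
    have dt: "((\<lambda>x. arccos (x / 2)) has_real_derivative - 1 / (2 * sin t)) (at x)"
      unfolding st using x
      by (auto intro!: derivative_eq_intros simp: field_simps)
    have "(H has_real_derivative - 2 * (cos (j * t) * (j * (- 1 / (2 * sin t))) / j -
        cos (real (j + 2) * t) * (real (j + 2) * (- 1 / (2 * sin t))) / real (j + 2))) (at x)"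
      unfolding H_def t_def
      by (intro DERIV_cmult DERIV_diff DERIV_cdivide DERIV_chain2[OF DERIV_sin] dt[unfolded t_def])
    also have "- 2 * (cos (j * t) * (j * (- 1 / (2 * sin t))) / j -
        cos (real (j + 2) * t) * (real (j + 2) * (- 1 / (2 * sin t))) / real (j + 2)) =
        (cos (j * t) - cos (real (j + 2) * t)) / sin t"
      using assms pos by (simp add: diff_divide_distrib)
    also have "cos (j * t) - cos (real (j + 2) * t) = 2 * sin (real (Suc j) * t) * sin t"
    proof -
      have "j * t = real (Suc j) * t - t" "real (j + 2) * t = real (Suc j) * t + t"
        by (simp_all add: algebra_simps)
      then show ?thesis by (simp only: cos_add cos_diff)
    qed
    also have "2 * sin (real (Suc j) * t) * sin t / sin t = chebyshev_S j x * sqrt (4 - x\<^sup>2)"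
      unfolding chebyshev_S_cos[symmetric] xt[symmetric] root using pos by simp
    finally show "(H has_vector_derivative chebyshev_S j x * sqrt (4 - x\<^sup>2)) (at x)"
      by (simp add: has_real_derivative_iff_has_vector_derivative)
  qed simp
  \<comment> \<open>The endpoints 2 and -2 correspond to \<open>t = 0\<close> and
    \<open>t = pi\<close>, where both sines vanish.\<close>
  moreover have "sin (real k * pi) = 0" for k by (rule sin_npi)
  then have "H 2 = 0" "H (-2) = 0" unfolding H_def by (simp_all del: of_nat_add of_nat_Suc)
  ultimately show ?thesis by simp
qed

lemma semicircle_density_nonneg: "semicircle_density x \<ge> 0"
  by (auto simp: semicircle_density_def power2_eq_square abs_le_square_iff
      intro!: divide_nonneg_nonneg mult_mono[of "\<bar>x\<bar>" 2 "\<bar>x\<bar>" 2, simplified])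

section \<open>Moments of the semicircle law\<close>

context
  fixes P :: "'b measure" and s :: "'b \<Rightarrow> real"
  assumes P: "prob_space P"
    and s: "distributed P lborel s (\<lambda>x. ennreal (semicircle_density x))"
begin

lemma semicircle_integrable:
  fixes f :: "real \<Rightarrow> real"
  assumes "continuous_on UNIV f"
  shows "integrable P (\<lambda>\<omega>. f (s \<omega>))"
proof -
  have "set_integrable lborel {-2..2} (\<lambda>x. sqrt (4 - x\<^sup>2) / (2 * pi) * f x)"
    by (intro borel_integrable_atLeastAtMost' continuous_intros continuous_on_subset[OF assms]) auto
  also have "set_integrable lborel {-2..2} (\<lambda>x. sqrt (4 - x\<^sup>2) / (2 * pi) * f x) =
      integrable lborel (\<lambda>x. semicircle_density x * f x)"
    unfolding set_integrable_def
    by (rule Bochner_Integration.integrable_cong) (auto simp: semicircle_density_def indicator_def)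
  finally show ?thesis
    using distributed_integrable[OF s, of f] assms semicircle_density_nonneg
    by (simp add: borel_measurable_continuous_onI)
qed

text \<open>For \<open>j = 0\<close> the value is the total mass of \<open>P\<close>, so the density
  itself is never integrated; for \<open>j \<ge> 1\<close> this is orthogonality to the
  constants.\<close>

lemma semicircle_chebyshev_S:
  "integral\<^sup>L P (\<lambda>\<omega>. chebyshev_S j (s \<omega>)) = of_bool (j = 0)"
proof (cases "j = 0")
  case True
  then show ?thesis using P by (simp add: prob_space.prob_space)
next
  case False
  let ?f = "\<lambda>x. chebyshev_S j x * sqrt (4 - x\<^sup>2)"
  have int: "set_integrable lborel {-2..2} ?f"
    by (intro borel_integrable_atLeastAtMost' continuous_intros)
  have "integral\<^sup>L P (\<lambda>\<omega>. chebyshev_S j (s \<omega>)) = (\<integral>x. semicircle_density x * chebyshev_S j x \<partial>lborel)"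
    using distributed_integral[OF s, of "chebyshev_S j"] semicircle_density_nonneg by simp
  also have "\<dots> = (\<integral>x. (1 / (2 * pi)) * (indicator {-2..2} x *\<^sub>R ?f x) \<partial>lborel)"
    by (rule Bochner_Integration.integral_cong) (auto simp: semicircle_density_def indicator_def)
  also have "\<dots> = (1 / (2 * pi)) * (LINT x:{-2..2}|lborel. ?f x)"
    unfolding set_lebesgue_integral_def by simp
  also have "(LINT x:{-2..2}|lborel. ?f x) = integral {-2..2} ?f"
    by (rule set_borel_integral_eq_integral(2)[OF int])
  also have "\<dots> = 0"
    using chebyshev_S_has_integral_0[of j] False by (intro integral_unique) simp
  finally show ?thesis using False by simp
qed

text \<open>\<open>chebyshev_S_mult\<close> gives these integrals the recursion of
  \<open>riordan\<close>, and orthogonality gives the same initial values, so the limit moments are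
  identified without a closed form.\<close>

lemma semicircle_moment_chebyshev_S:
  "integral\<^sup>L P (\<lambda>\<omega>. ((s \<omega>)\<^sup>2 - 1) ^ m * chebyshev_S (2 * k) (s \<omega>)) = riordan m k"
proof (induction m arbitrary: k)
  case 0
  then show ?case by (simp add: semicircle_chebyshev_S)
next
  case (Suc m)
  let ?h = "\<lambda>k \<omega>. ((s \<omega>)\<^sup>2 - 1) ^ m * chebyshev_S (2 * k) (s \<omega>)"
  have int: "integrable P (?h k)" for k
    by (rule semicircle_integrable[of "\<lambda>x. (x\<^sup>2 - 1) ^ m * chebyshev_S (2 * k) x"])
      (intro continuous_intros)
  have "((s \<omega>)\<^sup>2 - 1) ^ Suc m * chebyshev_S (2 * k) (s \<omega>) =
      ?h (Suc k) \<omega> + of_bool (k \<ge> 1) * (?h k \<omega> + ?h (k - 1) \<omega>)" for \<omega>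
  proof -
    have "((s \<omega>)\<^sup>2 - 1) ^ Suc m * chebyshev_S (2 * k) (s \<omega>) =
        ((s \<omega>)\<^sup>2 - 1) ^ m * (((s \<omega>)\<^sup>2 - 1) * chebyshev_S (2 * k) (s \<omega>))" by simp
    then show ?thesis unfolding chebyshev_S_mult by (simp only: distrib_left mult.left_commute)
  qed
  then have "integral\<^sup>L P (\<lambda>\<omega>. ((s \<omega>)\<^sup>2 - 1) ^ Suc m * chebyshev_S (2 * k) (s \<omega>)) =
      integral\<^sup>L P (\<lambda>\<omega>. ?h (Suc k) \<omega> + of_bool (k \<ge> 1) * (?h k \<omega> + ?h (k - 1) \<omega>))"
    by presburger
  also have "\<dots> = integral\<^sup>L P (?h (Suc k)) +
      of_bool (k \<ge> 1) * (integral\<^sup>L P (?h k) + integral\<^sup>L P (?h (k - 1)))"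
  proof -
    have "integral\<^sup>L P (\<lambda>\<omega>. a \<omega> + c * (b \<omega> + d \<omega>)) =
        integral\<^sup>L P a + c * (integral\<^sup>L P b + integral\<^sup>L P d)"
      if "integrable P a" "integrable P b" "integrable P d" for a b d :: "'b \<Rightarrow> real" and c
      using that by simp
    then show ?thesis using int by blast
  qed
  finally show ?case unfolding Suc riordan.simps .
qed

end

section \<open>Convergence of the moments to those of the shifted square\<close>

theorem theorem4p7:
  fixes V :: "'a set" and E :: "'a set set" and e :: 'a
    and P :: "'b measure" and s :: "'b \<Rightarrow> real"
  assumes "simple_graph V E" and "finite V" and "graph_connected V E"
    and "e \<in> V" and "card V \<ge> 2"
    and "prob_space P"
    and "distributed P lborel s (\<lambda>x. ennreal (semicircle_density x))"
  defines "\<sigma> \<equiv> graph_degree V E e"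
    and "A2 \<equiv> (\<lambda>n. adjacency_matrix
                 (distance_edges 2 (free_power_verts V e n) (free_power_edges V E e n)))"
  shows "moments_converge_to
           (\<lambda>n. vacuum_moment (free_power_verts V e n) []
                  (\<lambda>x y. inverse (real n * real \<sigma>) * A2 n x y))
           (distr P borel (\<lambda>\<omega>. (s \<omega>)\<^sup>2 - 1))"
proof -
  interpret rooted_graph V E e
    using assms by unfold_locales
  have sigma: "\<sigma> = card root_nbrs"
    by (simp add: \<sigma>_def graph_degree_def root_nbrs_def)
  \<comment> \<open>A walk from \<open>e\<close> to a second vertex has a first edge, whose other
    end is a root neighbour.\<close>
  have "card root_nbrs \<ge> 1"
  proof -
    have "\<not> V \<subseteq> {e}" using assms(5) card_mono[of "{e}" V] by auto
    then obtain y where y: "y \<in> V" "y \<noteq> e" by blast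
    then obtain p where p: "graph_walk V E e p y"
      using assms(3,4) unfolding graph_connected_def by blast
    then obtain z q where "p = e # z # q"
      using y by (cases p; cases "tl p") (auto simp: graph_walk_def)
    with p have "z \<in> root_nbrs" by (auto simp: graph_walk_def root_nbrs_def)
    then show ?thesis by (metis One_nat_def Suc_leI card_gt_0_iff empty_iff finite_root_nbrs)
  qed
  note lim = vacuum_moment_tendsto[OF this]
  have [measurable]: "s \<in> borel_measurable P"
    using distributed_measurable[OF assms(7)] by simp
  have int: "integrable P (\<lambda>\<omega>. ((s \<omega>)\<^sup>2 - 1) ^ m)" for m
    by (rule semicircle_integrable[OF assms(6,7), of "\<lambda>x. (x\<^sup>2 - 1) ^ m"]) (intro continuous_intros)
  \<comment> \<open>The case \<open>k = 0\<close>, where the Chebyshev factor is 1.\<close>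
  have "integral\<^sup>L P (\<lambda>\<omega>. ((s \<omega>)\<^sup>2 - 1) ^ m) = riordan m 0" for m
    using semicircle_moment_chebyshev_S[OF assms(6,7), of m 0] by simp
  then show ?thesis
    unfolding moments_converge_to_def sigma A2_def using int lim
    by (simp add: integrable_distr_eq integral_distr)
qed

end
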